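(* Let $\mathbf{D}_{n,1/2}$ be the degree of a uniformly chosen vertex of the random cluster graph $\mathbf{CG}_{n,1/2}$. Then, as $n\to\infty$, $$\frac{\mathbf{D}_{n,1/2}-\mathbb{E}\mathbf{D}_{n,1/2}}{\sqrt{\operatorname{Var}(\mathbf{D}_{n,1/2})}}\longrightarrow\mathcal{N}(0,1)\quad\text{in distribution.}$$
   Context: A cluster graph is a simple undirected graph on the labelled vertex set $\{1,\dots,n\}$ every connected component of which is a complete graph. For $p\in(0,1)$, the random cluster graph $\mathbf{CG}_{n,p}$ is the Erdős–Rényi random graph on $n$ vertices with edge probability $p$ (each of the $\binom n2$ edges present independently with probability $p$), conditioned on the event that it is a cluster graph. The uniform vertex is chosen independently of the graph. $\mathcal{N}(0,1)$ is the standard Gaussian law. *)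

theory Defs
  imports "HOL-Probability.Probability"
begin

text \<open>
  A simple graph on the vertex set \<open>{1..n}\<close> is identified with its edge set, a set of
  2-element subsets of \<open>{1..n}\<close>.
\<close>

definition vertex_pairs :: "nat \<Rightarrow> nat set set" where
  "vertex_pairs n = {e. e \<subseteq> {1..n} \<and> card e = 2}"

definition adj_rel :: "nat set set \<Rightarrow> (nat \<times> nat) set" where
  "adj_rel E = {(u, v). {u, v} \<in> E}"

definition connected_components :: "nat \<Rightarrow> nat set set \<Rightarrow> nat set set" where
  "connected_components n E = {1..n} // (adj_rel E)\<^sup>*"

definition complete_on :: "nat set \<Rightarrow> nat set set \<Rightarrow> bool" where
  "complete_on C E \<longleftrightarrow> (\<forall>u\<in>C. \<forall>v\<in>C. u \<noteq> v \<longrightarrow> {u, v} \<in> E)"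

definition cluster_graph :: "nat \<Rightarrow> nat set set \<Rightarrow> bool" where
  "cluster_graph n E \<longleftrightarrow>
     E \<subseteq> vertex_pairs n \<and> (\<forall>C\<in>connected_components n E. complete_on C E)"

definition erdos_renyi :: "nat \<Rightarrow> real \<Rightarrow> nat set set pmf" where
  "erdos_renyi n p =
     map_pmf (\<lambda>X. {e \<in> vertex_pairs n. X e})
       (Pi_pmf (vertex_pairs n) False (\<lambda>_. bernoulli_pmf p))"

definition random_cluster_graph :: "nat \<Rightarrow> real \<Rightarrow> nat set set pmf" where
  "random_cluster_graph n p = cond_pmf (erdos_renyi n p) {E. cluster_graph n E}"

definition degree :: "nat set set \<Rightarrow> nat \<Rightarrow> nat" where
  "degree E v = card {e \<in> E. v \<in> e}"

text \<open>
  The joint law of the random cluster graph and an independent uniform vertex. It is meaningful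
  for \<open>n \<ge> 1\<close> only, since \<^const>\<open>pmf_of_set\<close> is unspecified on the empty set.
\<close>

definition rooted_cluster_graph :: "nat \<Rightarrow> real \<Rightarrow> (nat set set \<times> nat) pmf" where
  "rooted_cluster_graph n p = pair_pmf (random_cluster_graph n p) (pmf_of_set {1..n})"

definition root_degree :: "nat set set \<times> nat \<Rightarrow> real" where
  "root_degree = (\<lambda>(E, v). real (degree E v))"

text \<open>
  \<^const>\<open>cond_pmf\<close> is only specified when the conditioning event meets the support. For
  \<open>p < 1\<close> the edgeless graph witnesses this.
\<close>

lemma cluster_graph_empty: "cluster_graph n {}"
proof -
  have "(adj_rel {})\<^sup>* = Id"
    by (simp add: adj_rel_def)
  then show ?thesis
    by (auto simp: cluster_graph_def connected_components_def complete_on_def quotient_def)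
qed

lemma erdos_renyi_meets_cluster_graph:
  assumes "0 < p" "p < 1"
  shows "set_pmf (erdos_renyi n p) \<inter> {E. cluster_graph n E} \<noteq> {}"
proof -
  have fin: "finite (vertex_pairs n)"
    by (rule finite_subset[of _ "Pow {1..n}"]) (auto simp: vertex_pairs_def)
  have "(\<lambda>_. False) \<in> set_pmf (Pi_pmf (vertex_pairs n) False (\<lambda>_. bernoulli_pmf p))"
    using assms fin by (auto simp: set_Pi_pmf PiE_dflt_def set_pmf_bernoulli)
  then have "{} \<in> set_pmf (erdos_renyi n p)"
    unfolding erdos_renyi_def set_map_pmf by (rule rev_image_eqI) simp
  with cluster_graph_empty show ?thesis by auto
qed

end

theory Submission
  imports Defs "HOL-Real_Asymp.Real_Asymp"
begin

text \<open>
  For \<open>p = 1/2\<close> the random cluster graph is a uniform random set partition, and the degree of a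
  uniform vertex equals \<open>k\<close> with probability
  \<open>(N choose k) * bell (N - k) / bell (N + 1)\<close>, where \<open>N = n - 1\<close>. By Dobinski's formula this law is
  a mixture of the binomial laws with parameters \<open>N\<close> and \<open>1/M\<close>, where \<open>M = m\<close> has probability
  proportional to \<open>m ^ n / m!\<close>. The ratios \<open>bell (n + 1) / bell n\<close> are monotone with increments
  at most \<open>2\<close>, which makes the variance of \<open>1/M\<close> so small that the characteristic function of the degree
  differs by \<open>o(1)\<close>, on the scale of the standard deviation, from the one of a Poisson law with the
  same mean. That mean tends to infinity and is asymptotic to the variance of the degree, so
  the central limit theorem for Poisson laws and Levy's continuity theorem apply.
\<close>

section \<open>Bell numbers\<close>

text \<open>Dobinski's formula serves as the definition of the Bell numbers.\<close>

definition bell :: "nat \<Rightarrow> real" where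
  "bell n = (\<Sum>m. real m ^ n / fact m) / exp 1"

text \<open>Since \<open>m ^ n / n!\<close> is one term of the series of
  \<open>exp m = (exp 1) ^ m\<close>, the exponential series at \<open>exp 1\<close>, times
  \<open>n!\<close>, is a majorant.\<close>

lemma summable_power_over_fact: "summable (\<lambda>m. real m ^ n / fact m)"
proof (rule summable_comparison_test')
  fix m :: nat assume m: "m \<ge> 1"
  have "real m ^ n \<le> fact n * exp (real m)"
  proof -
    have "(\<Sum>k\<in>{n}. real m ^ k / fact k) \<le> (\<Sum>k. real m ^ k / fact k)"
      using summable_exp[of "real m"]
      by (intro sum_le_suminf) (auto simp: field_simps)
    then show ?thesis
      by (simp add: exp_def field_simps scaleR_conv_of_real)
  qed
  also have "exp (real m) = exp 1 ^ m"
    by (simp add: exp_of_nat_mult[symmetric])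
  finally show "norm (real m ^ n / fact m) \<le> fact n * (exp 1 ^ m / fact m)"
    by (simp add: divide_simps)
next
  show "summable (\<lambda>m. fact n * (exp 1 ^ m / fact m :: real))"
    using summable_exp_generic[of "exp 1 :: real"]
    by (intro summable_mult) (simp add: field_simps)
qed

lemma bell_sums: "(\<lambda>m. real m ^ n / fact m) sums (exp 1 * bell n)"
  using summable_sums[OF summable_power_over_fact, of n] by (simp add: bell_def)

lemma bell_sums_complex:
  "(\<lambda>m. of_nat m ^ n / fact m :: complex) sums (of_real (exp 1 * bell n))"
  using sums_of_real[OF bell_sums[of n], where ?'a = complex] by simp

text \<open>Binomial expansion of every term, then Dobinski's series for each power. At
  \<open>x = 1\<close> this yields the recurrence; on the unit circle it turns the generating
  function of the degree into a mixture.\<close>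

lemma bell_binomial_sums:
  fixes x :: complex
  shows "(\<lambda>m. (of_nat m + x) ^ n / fact m)
    sums (of_real (exp 1) * (\<Sum>k\<le>n. of_nat (n choose k) * of_real (bell (n - k)) * x ^ k))"
proof -
  have "(\<lambda>m. \<Sum>k\<le>n. of_nat (n choose k) * x ^ k * (of_nat m ^ (n - k) / fact m))
     sums (\<Sum>k\<le>n. of_nat (n choose k) * x ^ k * of_real (exp 1 * bell (n - k)))"
    by (intro sums_sum sums_mult bell_sums_complex)
  moreover have "(\<Sum>k\<le>n. of_nat (n choose k) * x ^ k * (of_nat m ^ (n - k) / fact m))
     = (of_nat m + x) ^ n / fact m" for m
    unfolding add.commute[of _ x] binomial_ring
    by (simp add: sum_divide_distrib)
  ultimately show ?thesis
    by (simp add: sum_distrib_left mult_ac)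
qed

text \<open>In the series for \<open>Suc n\<close> the term at \<open>0\<close> vanishes and one
  factor \<open>m\<close> cancels against \<open>fact m\<close>.\<close>

lemma bell_Suc_sums: "(\<lambda>m. real (Suc m) ^ n / fact m) sums (exp 1 * bell (Suc n))"
proof -
  have "(\<lambda>m. real (Suc m) ^ Suc n / fact (Suc m)) sums (exp 1 * bell (Suc n))"
    using bell_sums[of "Suc n"] by (subst sums_Suc_iff) simp
  moreover have "real (Suc m) ^ Suc n / fact (Suc m) = real (Suc m) ^ n / fact m" for m
    by (simp add: fact_Suc field_simps del: of_nat_Suc)
  ultimately show ?thesis by simp
qed

text \<open>Two evaluations of the sum of \<open>(m + 1) ^ n / m!\<close>, compared over the complex
  numbers because the binomial one is stated there.\<close>

lemma bell_Suc: "bell (Suc n) = (\<Sum>k\<le>n. real (n choose k) * bell (n - k))"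
proof -
  have "(\<lambda>m. complex_of_real (real (Suc m) ^ n / fact m)) sums of_real (exp 1 * bell (Suc n))"
    by (intro sums_of_real bell_Suc_sums)
  moreover have "(\<lambda>m. complex_of_real (real (Suc m) ^ n / fact m)) sums
     of_real (exp 1 * (\<Sum>k\<le>n. real (n choose k) * bell (n - k)))"
    using bell_binomial_sums[of 1 n] by (simp add: add.commute)
  ultimately have "complex_of_real (exp 1 * bell (Suc n)) =
      of_real (exp 1 * (\<Sum>k\<le>n. real (n choose k) * bell (n - k)))"
    by (rule sums_unique2)
  then show ?thesis
    unfolding of_real_eq_iff by simp
qed

lemma bell_0 [simp]: "bell 0 = 1"
proof -
  have "(\<Sum>m. 1 / fact m) = exp (1::real)"
    by (simp add: exp_def inverse_eq_divide)
  then show ?thesis by (simp add: bell_def)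
qed

lemma bell_ge_1: "bell n \<ge> 1"
proof (induction n rule: less_induct)
  case (less n)
  show ?case
  proof (cases n)
    case (Suc m)
    \<comment> \<open>The term \<open>k = m\<close> is \<open>bell 0 = 1\<close>; the induction
      hypothesis makes the others nonnegative.\<close>
    have "real (m choose m) * bell (m - m) \<le> bell n"
      unfolding Suc bell_Suc using less.IH Suc
      by (intro member_le_sum mult_nonneg_nonneg)
        (force simp: less_Suc_eq_le order_trans[OF zero_le_one])+
    then show ?thesis by simp
  qed simp
qed

lemma bell_pos [simp]: "bell n > 0"
  using bell_ge_1[of n] by linarith

lemma bell_nonzero [simp]: "bell n \<noteq> 0"
  using bell_pos[of n] by linarith

lemma bell_mono_Suc: "bell n \<le> bell (Suc n)"
proof (cases n)
  case 0
  then show ?thesis using bell_ge_1[of 1] by simp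
next
  case (Suc k)
  have "exp 1 * bell (Suc k) \<le> exp 1 * bell (Suc (Suc k))"
    by (rule sums_le[OF _ bell_Suc_sums bell_Suc_sums]) (simp add: divide_right_mono)
  with Suc show ?thesis by simp
qed

text \<open>Cauchy-Schwarz for the weights \<open>m ^ n / m!\<close>: the second moment about
  \<open>c\<close>, the mean of \<open>m\<close>, is nonnegative.\<close>

lemma bell_log_convex: "bell (Suc n) ^ 2 \<le> bell n * bell (Suc (Suc n))"
proof -
  define c where "c = bell (Suc n) / bell n"
  have "(\<lambda>m. real m ^ Suc (Suc n) / fact m - 2 * c * (real m ^ Suc n / fact m)
      + c\<^sup>2 * (real m ^ n / fact m)) sums
      (exp 1 * bell (Suc (Suc n)) - 2 * c * (exp 1 * bell (Suc n)) + c\<^sup>2 * (exp 1 * bell n))"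
    by (intro sums_add sums_diff sums_mult bell_sums)
  moreover have "real m ^ Suc (Suc n) / fact m - 2 * c * (real m ^ Suc n / fact m)
      + c\<^sup>2 * (real m ^ n / fact m) = real m ^ n * (real m - c)\<^sup>2 / fact m" for m
    by (simp add: field_simps power2_eq_square)
  ultimately have S: "(\<lambda>m. real m ^ n * (real m - c)\<^sup>2 / fact m) sums
      (exp 1 * bell (Suc (Suc n)) - 2 * c * (exp 1 * bell (Suc n)) + c\<^sup>2 * (exp 1 * bell n))"
    by (simp only:)
  have "0 \<le> exp 1 * bell (Suc (Suc n)) - 2 * c * (exp 1 * bell (Suc n)) + c\<^sup>2 * (exp 1 * bell n)"
    by (rule sums_le[OF _ sums_zero S]) simp
  also have "\<dots> = exp 1 * (bell (Suc (Suc n)) - 2 * c * bell (Suc n) + c\<^sup>2 * bell n)"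
    by (simp add: algebra_simps)
  finally have "0 \<le> bell (Suc (Suc n)) - 2 * c * bell (Suc n) + c\<^sup>2 * bell n"
    by (simp add: zero_le_mult_iff)
  also have "\<dots> = bell (Suc (Suc n)) - bell (Suc n) ^ 2 / bell n"
    by (simp add: c_def power2_eq_square)
  finally show ?thesis by (simp add: field_simps)
qed

section \<open>Ratios of consecutive Bell numbers\<close>

definition bell_ratio :: "nat \<Rightarrow> real" where
  "bell_ratio n = bell (Suc n) / bell n"

lemma bell_ratio_pos [simp]: "bell_ratio n > 0"
  by (simp add: bell_ratio_def)

lemma bell_ratio_nonzero [simp]: "bell_ratio n \<noteq> 0"
  using bell_ratio_pos[of n] by linarith

lemma mono_bell_ratio: "mono bell_ratio"
proof (rule incseq_SucI)
  fix n show "bell_ratio n \<le> bell_ratio (Suc n)"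
    using bell_log_convex[of n] by (simp add: bell_ratio_def field_simps power2_eq_square)
qed

text \<open>
  Under the weights \<open>w m\<close> below, \<open>u\<close> and \<open>(1 + u) ^ (n + 2)\<close> are positively correlated, both being
  increasing in \<open>u\<close>. Centring \<open>u\<close> at its mean \<open>c\<close> and the power at its value \<open>G\<close> at \<open>c\<close> makes every
  single term of the covariance nonnegative.
\<close>

lemma bell_product_bound:
  "bell (n + 1) * bell (n + 3) \<le> bell (n + 2) ^ 2 + 2 * bell (n + 1) * bell (n + 2)"
proof -
  define c where "c = bell (n + 1) / bell (n + 2)"
  have c: "0 < c" "c \<le> 1"
    using bell_mono_Suc[of "n + 1"] by (simp_all add: c_def)
  define w where "w = (\<lambda>m. real (Suc m) ^ (n + 1) / fact m)"
  have w_nonneg: "w m \<ge> 0" for m by (simp add: w_def)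
  define u where "u = (\<lambda>m. 1 / real (Suc m))"
  have sum_w: "w sums (exp 1 * bell (n + 2))"
    using bell_Suc_sums[of "n + 1"] by (simp add: w_def)
  have sum_wu: "(\<lambda>m. w m * u m) sums (exp 1 * bell (n + 1))"
    using bell_Suc_sums[of n] by (simp add: w_def u_def field_simps del: of_nat_Suc)
  \<comment> \<open>The series of \<open>exp 1 * bell (n + 3)\<close> moved by one index; the
    \<open>- 1\<close> is its missing first term. As \<open>1 + u m = (m + 2) / (m + 1)\<close>, its
    terms are the weights times the power.\<close>
  have "(\<lambda>m. real (Suc (Suc m)) ^ (n + 2) / fact (Suc m)) sums (exp 1 * bell (n + 3) - 1)"
    using bell_Suc_sums[of "n + 2"] by (subst sums_Suc_iff) (simp add: numeral_3_eq_3)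
  moreover have "real (Suc (Suc m)) ^ (n + 2) / fact (Suc m) = w m * (1 + u m) ^ (n + 2)" for m
  proof -
    have "1 + u m = real (Suc (Suc m)) / real (Suc m)"
      by (simp add: u_def field_simps)
    then have "w m * (1 + u m) ^ (n + 2)
        = real (Suc m) ^ (n + 1) / fact m * (real (Suc (Suc m)) / real (Suc m)) ^ (n + 2)"
      unfolding w_def by (rule arg_cong)
    also have "\<dots> = real (Suc (Suc m)) ^ (n + 2) / (real (Suc m) * fact m)"
    proof -
      have *: "T ^ (n + 1) / F * (S / T) ^ (n + 2) = S ^ (n + 2) / (T * F)" if "T \<noteq> 0"
        for S T F :: real
        using that by (simp add: power_divide)
      show ?thesis by (rule *) simp
    qed
    also have "real (Suc m) * fact m = fact (Suc m)"
      by (rule fact_Suc[symmetric])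
    finally show ?thesis ..
  qed
  note g = this
  ultimately have sum_wg: "(\<lambda>m. w m * (1 + u m) ^ (n + 2)) sums (exp 1 * bell (n + 3) - 1)"
    by simp
  \<comment> \<open>The majorant rests on \<open>(m + 2)^2 / (m + 1) <= (m + 2) + 2\<close>, an
    equality at \<open>m = 0\<close>. This is the origin of the constant \<open>2\<close> in the
    bound.\<close>
  define v where "v = (\<lambda>m. real (Suc (Suc m)) ^ (n + 1) / fact (Suc m)
           + 2 * (real (Suc (Suc m)) ^ n / fact (Suc m)))"
  have sum_v: "v sums ((exp 1 * bell (n + 2) - 1) + 2 * (exp 1 * bell (n + 1) - 1))"
    using bell_Suc_sums[of "n + 1"] bell_Suc_sums[of n]
    unfolding v_def by (intro sums_add sums_mult; subst sums_Suc_iff) simp_all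
  have le_v: "w m * (1 + u m) ^ (n + 2) * u m \<le> v m" for m
  proof -
    have "real (Suc (Suc m)) ^ 2 / real (Suc m) \<le> real (Suc (Suc m)) + 2"
      by (simp add: field_simps power2_eq_square)
    then have "real (Suc (Suc m)) ^ n / fact (Suc m) * (real (Suc (Suc m)) ^ 2 / real (Suc m))
        \<le> real (Suc (Suc m)) ^ n / fact (Suc m) * (real (Suc (Suc m)) + 2)"
      by (rule mult_left_mono) simp
    moreover have "S ^ n / F * (S ^ 2 / T) = S ^ (n + 2) / F * (1 / T)"
        "S ^ n / F * (S + 2) = S ^ (n + 1) / F + 2 * (S ^ n / F)" for S T F :: real
      by (simp_all add: power_add power2_eq_square add_divide_distrib distrib_left mult_ac)
    ultimately show ?thesis
      unfolding g[symmetric] unfolding u_def v_def by (simp only:)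
  qed
  have "summable (\<lambda>m. w m * (1 + u m) ^ (n + 2) * u m)"
  proof (rule summable_comparison_test'[OF sums_summable[OF sum_v]])
    show "norm (w m * (1 + u m) ^ (n + 2) * u m) \<le> v m" for m
      using le_v[of m] w_nonneg[of m] by (simp add: abs_mult u_def)
  qed
  then obtain s where s: "(\<lambda>m. w m * (1 + u m) ^ (n + 2) * u m) sums s"
    by (auto simp: summable_def)
  define G where "G = (1 + c) ^ (n + 2)"
  have S: "(\<lambda>m. (w m * (1 + u m) ^ (n + 2) * u m - c * (w m * (1 + u m) ^ (n + 2)))
         - G * (w m * u m - c * w m)) sums
        ((s - c * (exp 1 * bell (n + 3) - 1)) - G
          * (exp 1 * bell (n + 1) - c * (exp 1 * bell (n + 2))))"
    by (intro sums_diff sums_mult s sum_wg sum_wu sum_w)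
  have nonneg: "0 \<le> (w m * (1 + u m) ^ (n + 2) * u m - c * (w m * (1 + u m) ^ (n + 2)))
         - G * (w m * u m - c * w m)" for m
  proof -
    have "0 \<le> (u m - c) * ((1 + u m) ^ (n + 2) - G)"
    proof (cases "u m \<le> c")
      case True
      then have "(1 + u m) ^ (n + 2) \<le> G"
        unfolding G_def by (intro power_mono) (auto simp: u_def)
      with True show ?thesis by (intro mult_nonpos_nonpos) auto
    next
      case False
      then have "G \<le> (1 + u m) ^ (n + 2)"
        unfolding G_def using c by (intro power_mono) auto
      with False show ?thesis by (intro mult_nonneg_nonneg) auto
    qed
    with w_nonneg[of m] have "0 \<le> w m * ((u m - c) * ((1 + u m) ^ (n + 2) - G))"
      by (rule mult_nonneg_nonneg)
    then show ?thesis by (simp add: algebra_simps)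
  qed
  have "0 \<le> (s - c * (exp 1 * bell (n + 3) - 1)) - G
      * (exp 1 * bell (n + 1) - c * (exp 1 * bell (n + 2)))"
    by (rule sums_le[OF nonneg sums_zero S])
  \<comment> \<open>The factor of \<open>G\<close> vanishes because \<open>c\<close> is the mean of
    \<open>u\<close>.\<close>
  then have "c * (exp 1 * bell (n + 3) - 1) \<le> s"
    by (simp add: c_def)
  also have "s \<le> (exp 1 * bell (n + 2) - 1) + 2 * (exp 1 * bell (n + 1) - 1)"
    by (rule sums_le[OF le_v s sum_v])
  \<comment> \<open>The terms lost by shifting add up to \<open>c - 3\<close>, which is
    negative.\<close>
  finally have "exp 1 * (c * bell (n + 3)) \<le> exp 1 * (bell (n + 2) + 2 * bell (n + 1))"
    using c by (simp add: algebra_simps)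
  then have "c * bell (n + 3) \<le> bell (n + 2) + 2 * bell (n + 1)"
    by simp
  then show ?thesis
    by (simp add: c_def field_simps power2_eq_square)
qed

lemma bell_ratio_Suc_le: "bell_ratio (Suc n) \<le> bell_ratio n + 2"
proof (cases n)
  case 0
  show ?thesis
    by (simp add: 0 bell_ratio_def bell_Suc)
next
  case (Suc k)
  then show ?thesis
    using bell_product_bound[of k]
    by (simp add: bell_ratio_def field_simps power2_eq_square numeral_3_eq_3)
qed

lemma bell_ratio_diff_le: "bell_ratio (n + k) \<le> bell_ratio n + 2 * real k"
proof (induction k)
  case (Suc k)
  then show ?case using bell_ratio_Suc_le[of "n + k"] by simp
qed simp

text \<open>\<open>bell n / bell (n - k)\<close> is the product of the ratios from
  \<open>n - k\<close> to \<open>n - 1\<close>. By monotonicity the first of them bounds all from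
  below here, and \<open>bell_ratio n\<close> bounds all from above in the next lemma.\<close>

lemma bell_ratio_power_le:
  assumes "k \<le> n"
  shows "bell (n - k) * bell_ratio (n - k) ^ k \<le> bell n"
  using assms
proof (induction k)
  case (Suc k)
  define j where "j = n - Suc k"
  have j: "n - k = Suc j" using Suc.prems by (simp add: j_def)
  have "bell j * bell_ratio j ^ Suc k = bell (Suc j) * bell_ratio j ^ k"
    by (simp add: bell_ratio_def)
  also have "\<dots> \<le> bell (Suc j) * bell_ratio (Suc j) ^ k"
    using monoD[OF mono_bell_ratio, of j "Suc j"] less_imp_le[OF bell_ratio_pos[of j]]
    by (intro mult_left_mono power_mono) (simp_all add: less_imp_le)
  also have "\<dots> \<le> bell n"
    using Suc.IH Suc.prems by (simp add: j)
  finally show ?case by (simp add: j_def)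
qed simp

lemma bell_le_bell_ratio_power:
  assumes "k \<le> n"
  shows "bell n \<le> bell (n - k) * bell_ratio n ^ k"
  using assms
proof (induction k)
  case (Suc k)
  define j where "j = n - Suc k"
  have j: "n - k = Suc j" using Suc.prems by (simp add: j_def)
  have "bell n \<le> bell (Suc j) * bell_ratio n ^ k"
    using Suc.IH Suc.prems by (simp add: j)
  also have "bell (Suc j) = bell j * bell_ratio j"
    by (simp add: bell_ratio_def)
  also have "\<dots> \<le> bell j * bell_ratio n"
    using monoD[OF mono_bell_ratio, of j n]
    by (intro mult_left_mono) (simp_all add: less_imp_le j_def)
  finally show ?case
    by (simp add: j_def mult_right_mono less_imp_le mult_ac)
qed simp

section \<open>Growth of the ratios\<close>

text \<open>Keep the term \<open>k = 2\<close> of the recurrence for \<open>bell (n + 1)\<close>. It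
  gives growth of order at least \<open>n powr (2/3)\<close>; the term \<open>k = 1\<close> would
  give only the square root of \<open>n\<close>, too little to make
  \<open>n / bell_ratio n ^ 2\<close> vanish.\<close>

lemma bell_ratio_cube_ge:
  assumes "n \<ge> 2"
  shows "bell_ratio n ^ 3 \<ge> real n * (real n - 1) / 2"
proof -
  have "real (n choose 2) * bell (n - 2) \<le> bell (Suc n)"
    unfolding bell_Suc using assms
    by (intro member_le_sum mult_nonneg_nonneg) (auto simp: less_imp_le)
  also have "\<dots> = bell_ratio n * bell n"
    by (simp add: bell_ratio_def)
  also have "\<dots> \<le> bell_ratio n * (bell (n - 2) * bell_ratio n ^ 2)"
    using assms by (intro mult_left_mono bell_le_bell_ratio_power) (simp_all add: less_imp_le)
  also have "\<dots> = bell_ratio n ^ 3 * bell (n - 2)"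
    by (simp add: power2_eq_square power3_eq_cube)
  finally have "real (n choose 2) \<le> bell_ratio n ^ 3"
    by simp
  moreover have "real (n choose 2) = real n * (real n - 1) / 2"
    using assms by (subst choose_two) (simp add: real_of_nat_div of_nat_diff)
  ultimately show ?thesis by simp
qed

lemma bell_ratio_ge_powr:
  assumes "n \<ge> 2"
  shows "bell_ratio n \<ge> (real n * (real n - 1) / 2) powr (1 / 3)"
proof -
  have "(real n * (real n - 1) / 2) powr (1 / 3) \<le> (bell_ratio n ^ 3) powr (1 / 3)"
    using assms by (intro powr_mono2 bell_ratio_cube_ge) auto
  also have "\<dots> = bell_ratio n"
    unfolding powr_numeral[OF less_imp_le[OF bell_ratio_pos], symmetric] powr_powr
    by (simp add: less_imp_le)
  finally show ?thesis .
qed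

lemma filterlim_bell_ratio: "filterlim bell_ratio at_top sequentially"
proof (rule filterlim_at_top_mono)
  show "filterlim (\<lambda>n. (real n * (real n - 1) / 2) powr (1 / 3)) at_top sequentially"
    by real_asymp
  show "eventually (\<lambda>n. (real n * (real n - 1) / 2) powr (1 / 3) \<le> bell_ratio n) sequentially"
    using eventually_ge_at_top[of 2] by eventually_elim (rule bell_ratio_ge_powr)
qed

text \<open>This is the mean degree divided by a ratio. It controls both the gap between variance
  and mean and the error in the characteristic function.\<close>

lemma tendsto_over_bell_ratio_product:
  "(\<lambda>n. real (Suc n) / (bell_ratio n * bell_ratio (Suc n))) \<longlonglongrightarrow> 0"
proof (rule tendsto_sandwich[OF _ _ tendsto_const])
  show "(\<lambda>n. real (Suc n) / ((real n * (real n - 1) / 2) powr (1 / 3)) ^ 2) \<longlonglongrightarrow> 0"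
    by real_asymp
  show "eventually (\<lambda>n. real (Suc n) / (bell_ratio n * bell_ratio (Suc n))
      \<le> real (Suc n) / ((real n * (real n - 1) / 2) powr (1 / 3)) ^ 2) sequentially"
    using eventually_ge_at_top[of 2]
  proof eventually_elim
    case (elim n)
    have "((real n * (real n - 1) / 2) powr (1 / 3)) ^ 2 \<le> bell_ratio n * bell_ratio (Suc n)"
      unfolding power2_eq_square
      using bell_ratio_ge_powr[of n] monoD[OF mono_bell_ratio, of n "Suc n"] elim
      by (intro mult_mono) (auto simp: less_imp_le)
    with elim show ?case by (intro divide_left_mono) auto
  qed
qed (auto simp: less_imp_le)

section \<open>Factorial moments of the degree law\<close>

text \<open>Absorption of \<open>k\<close> into the binomial coefficient. The choices
  \<open>f k = 1\<close> and \<open>f k = k - 1\<close> give the first two factorial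
  moments.\<close>

lemma sum_index_mult_choose_bell_Suc:
  "(\<Sum>k\<le>Suc n. real k * f k * (real (Suc n choose k) * bell (Suc n - k)))
    = real (Suc n) * (\<Sum>k\<le>n. f (Suc k) * (real (n choose k) * bell (n - k)))"
proof -
  have "(\<Sum>k\<le>Suc n. real k * f k * (real (Suc n choose k) * bell (Suc n - k)))
      = (\<Sum>k\<le>n. f (Suc k) * real (Suc k * (Suc n choose Suc k)) * bell (n - k))"
    by (subst sum.atMost_Suc_shift) (simp add: mult_ac del: binomial_Suc_Suc of_nat_Suc mult_Suc)
  also have "\<dots> = real (Suc n) * (\<Sum>k\<le>n. f (Suc k) * (real (n choose k) * bell (n - k)))"
    unfolding Suc_times_binomial of_nat_mult sum_distrib_left by (simp only: mult_ac)
  finally show ?thesis .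
qed

lemma sum_index_mult_choose_bell:
  "(\<Sum>k\<le>n. real k * (real (n choose k) * bell (n - k))) = real n * bell n"
proof (cases n)
  case (Suc m)
  then show ?thesis
    using sum_index_mult_choose_bell_Suc[of "\<lambda>_. 1" m]
      by (simp add: bell_Suc[of m] del: of_nat_Suc binomial_Suc_Suc)
qed simp

lemma sum_index_mult_pred_choose_bell:
  "(\<Sum>k\<le>Suc n. real k * (real k - 1) * (real (Suc n choose k) * bell (Suc n - k)))
    = real (Suc n) * real n * bell n"
  using sum_index_mult_choose_bell_Suc[of "\<lambda>k. real k - 1" n]
  by (simp add: sum_index_mult_choose_bell del: binomial_Suc_Suc)

text \<open>
  If \<open>n / bell_ratio n\<close> were bounded, then for a uniform root in a random set partition every
  single block size would have probability tending to \<open>0\<close>, so the mean block size, which is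
  \<open>n / bell_ratio n\<close> up to \<open>1\<close>, would be unbounded.
\<close>

lemma filterlim_over_bell_ratio: "filterlim (\<lambda>n. real n / bell_ratio n) at_top sequentially"
  unfolding filterlim_at_top_gt[where c = 0]
proof (intro allI impI)
  fix C :: real assume C: "0 < C"
  \<comment> \<open>If the sizes below \<open>L\<close> carry at most half of the mass, the mean is
    at least \<open>L / 2\<close>, hence at least \<open>C\<close>.\<close>
  define L where "L = nat \<lceil>2 * C\<rceil>"
  have L: "2 * C \<le> real L" unfolding L_def by linarith
  define K where "K = (\<Sum>k<L. (2 * C) ^ Suc k)"
  have "eventually (\<lambda>n. n > max (4 * C * L) (2 * K)) (at_top :: real filter)"
    by (rule eventually_gt_at_top)
  then have "eventually (\<lambda>n. real n > max (4 * C * L) (2 * K)) sequentially"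
    by (rule eventually_compose_filterlim) (rule filterlim_real_sequentially)
  then show "eventually (\<lambda>n. C \<le> real n / bell_ratio n) sequentially"
    using eventually_gt_at_top[of 0] eventually_ge_at_top[of L]
  proof eventually_elim
    case (elim n)
    show ?case
    proof (rule ccontr)
      assume "\<not> ?case"
      then have less: "real n / C < bell_ratio n" using C by (simp add: field_simps)
      have nL: "4 * C * L < n" "2 * K < n" "L \<le> n" "0 < n" using elim by auto
      define b where "b = bell_ratio (n - L)"
      \<comment> \<open>The ratios fall by at most \<open>2 * L\<close> over \<open>L\<close>
        indices, and \<open>n > 4 * C * L\<close> lets \<open>n / C\<close> absorb this loss by
        halving.\<close>
      have "real n / (2 * C) + 2 * L \<le> real n / C"
        using nL C by (simp add: field_simps)
      also have "\<dots> \<le> b + 2 * L"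
        using bell_ratio_diff_le[of "n - L" L] less nL by (simp add: b_def)
      finally have b: "real n / (2 * C) \<le> b" by simp
      \<comment> \<open>\<open>bell (n + 1) / bell (n - k)\<close> contains \<open>k + 1\<close>
        ratios, each at least \<open>n / (2 * C)\<close>, against at most \<open>n ^ k\<close>
        choices; the extra ratio leaves the decay \<open>1 / n\<close>.\<close>
      have term_le: "real (n choose k) * bell (n - k) \<le> (2 * C) ^ Suc k / n * bell (Suc n)"
        if "k < L" for k
      proof -
        have kn: "k \<le> n" using that nL by simp
        have "real (n choose k) \<le> real n ^ k"
          using binomial_le_pow[OF kn] by (simp flip: of_nat_power)
        also have "\<dots> = (2 * C) ^ Suc k / n * (real n / (2 * C)) ^ Suc k"
          using C nL by (simp add: field_simps)
        also have "\<dots> \<le> (2 * C) ^ Suc k / n * bell_ratio (n - k) ^ Suc k"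
        proof -
          have "b \<le> bell_ratio (n - k)"
            unfolding b_def using that by (intro monoD[OF mono_bell_ratio]) simp
          with b have "real n / (2 * C) \<le> bell_ratio (n - k)" by linarith
          then show ?thesis
            using C by (intro mult_left_mono power_mono) (auto simp: less_imp_le)
        qed
        finally have "real (n choose k) * bell (n - k)
            \<le> (2 * C) ^ Suc k / n * bell_ratio (n - k) ^ Suc k * bell (n - k)"
          by (rule mult_right_mono) (simp add: less_imp_le)
        also have "\<dots> = (2 * C) ^ Suc k / n
            * (bell (Suc n - Suc k) * bell_ratio (Suc n - Suc k) ^ Suc k)"
          by simp
        also have "\<dots> \<le> (2 * C) ^ Suc k / n * bell (Suc n)"
          using C kn by (intro mult_left_mono bell_ratio_power_le) auto
        finally show ?thesis .
      qed
      have "real L * bell (Suc n) - real L * (\<Sum>k<L. real (n choose k) * bell (n - k))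
          = real L * (\<Sum>k=L..n. real (n choose k) * bell (n - k))"
      proof -
        have "{..n} = {..<L} \<union> {L..n}" using nL by auto
        then have "bell (Suc n)
            = (\<Sum>k<L. real (n choose k) * bell (n - k))
              + (\<Sum>k=L..n. real (n choose k) * bell (n - k))"
          unfolding bell_Suc by (simp only:) (rule sum.union_disjoint, auto)
        then show ?thesis by (simp add: algebra_simps)
      qed
      \<comment> \<open>Markov's inequality for the event that the degree is at least
        \<open>L\<close>.\<close>
      also have "\<dots> \<le> (\<Sum>k=L..n. real k * (real (n choose k) * bell (n - k)))"
        unfolding sum_distrib_left by (intro sum_mono mult_right_mono) (auto simp: less_imp_le)
      also have "\<dots> \<le> (\<Sum>k\<le>n. real k * (real (n choose k) * bell (n - k)))"
        by (intro sum_mono2) (auto simp: less_imp_le)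
      also have "\<dots> = real n * bell n"
        by (rule sum_index_mult_choose_bell)
      also have "\<dots> = real n / bell_ratio n * bell (Suc n)"
        by (simp add: bell_ratio_def)
      also have "\<dots> < C * bell (Suc n)"
        using less C by (intro mult_strict_right_mono) (simp_all add: field_simps)
      finally have *: "real L * bell (Suc n)
          < C * bell (Suc n) + real L * (\<Sum>k<L. real (n choose k) * bell (n - k))"
        by simp
      have "(\<Sum>k<L. real (n choose k) * bell (n - k)) \<le> K / n * bell (Suc n)"
        unfolding K_def sum_divide_distrib sum_distrib_right using term_le by (intro sum_mono) simp
      also have "\<dots> \<le> 1 / 2 * bell (Suc n)"
        using nL by (intro mult_right_mono) (simp_all add: field_simps less_imp_le)
      finally have "real L * (\<Sum>k<L. real (n choose k) * bell (n - k))
          \<le> real L * (1 / 2 * bell (Suc n))"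
        by (rule mult_left_mono) simp
      with * have "real L * bell (Suc n) < 2 * C * bell (Suc n)"
        by linarith
      then show False using L by simp
    qed
  qed
qed

section \<open>Counting cluster graphs by the degree of a vertex\<close>

text \<open>Absence of an induced path on three vertices, the local form of being a disjoint union
  of cliques. The vertex set is arbitrary because the count removes a clique and recurses on the
  rest.\<close>

definition cluster_graphs_on :: "nat set \<Rightarrow> nat set set set" where
  "cluster_graphs_on A = {E. E \<subseteq> {e. e \<subseteq> A \<and> card e = 2} \<and>
     (\<forall>u v w. {u, v} \<in> E \<longrightarrow> {v, w} \<in> E \<longrightarrow> u \<noteq> w \<longrightarrow> {u, w} \<in> E)}"

lemma cluster_graphs_on_edge:
  assumes "E \<in> cluster_graphs_on A" "{u, v} \<in> E"
  shows "u \<in> A" "v \<in> A" "u \<noteq> v"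
proof -
  have "{u, v} \<subseteq> A" "card {u, v} = 2"
    using assms by (auto simp: cluster_graphs_on_def)
  then show "u \<in> A" "v \<in> A" "u \<noteq> v" by auto
qed

lemma cluster_graphs_on_trans:
  assumes "E \<in> cluster_graphs_on A" "{u, v} \<in> E" "{v, w} \<in> E" "u \<noteq> w"
  shows "{u, w} \<in> E"
  using assms unfolding cluster_graphs_on_def by blast

lemma cluster_graphs_on_edgeE:
  assumes "E \<in> cluster_graphs_on A" "e \<in> E"
  obtains u v where "e = {u, v}" "u \<noteq> v" "u \<in> A" "v \<in> A"
proof -
  have "e \<subseteq> A" "card e = 2" using assms by (auto simp: cluster_graphs_on_def)
  then show thesis using that by (auto simp: card_2_iff)
qed

lemma finite_cluster_graphs_on: "finite A \<Longrightarrow> finite (cluster_graphs_on A)"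
  by (rule finite_subset[of _ "Pow (Pow A)"]) (auto simp: cluster_graphs_on_def)

text \<open>A path of two edges stays inside one component, which is complete; conversely,
  transitivity contracts every path to an edge or a point.\<close>

lemma cluster_graph_iff: "cluster_graph n E \<longleftrightarrow> E \<in> cluster_graphs_on {1..n}"
proof
  assume *: "cluster_graph n E"
  have "{u, w} \<in> E" if "{u, v} \<in> E" "{v, w} \<in> E" "u \<noteq> w" for u v w
  proof -
    have "u \<in> {1..n}"
      using * that by (auto simp: cluster_graph_def vertex_pairs_def)
    then have "(adj_rel E)\<^sup>* `` {u} \<in> connected_components n E"
      by (simp add: connected_components_def quotientI)
    with * have "complete_on ((adj_rel E)\<^sup>* `` {u}) E"
      by (simp add: cluster_graph_def)
    moreover have "(u, v) \<in> adj_rel E" "(v, w) \<in> adj_rel E"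
      using that by (auto simp: adj_rel_def)
    then have "(u, w) \<in> (adj_rel E)\<^sup>*" by (meson r_into_rtrancl rtrancl_trans)
    ultimately show ?thesis using that by (simp add: complete_on_def)
  qed
  with * show "E \<in> cluster_graphs_on {1..n}"
    by (auto simp: cluster_graph_def cluster_graphs_on_def vertex_pairs_def)
next
  assume *: "E \<in> cluster_graphs_on {1..n}"
  have reach: "x = y \<or> {x, y} \<in> E" if "(x, y) \<in> (adj_rel E)\<^sup>*" for x y
    using that
  proof induction
    case (step y z)
    then have "{y, z} \<in> E" by (simp add: adj_rel_def)
    with step.IH show ?case
      using cluster_graphs_on_trans[OF *] by blast
  qed simp
  have "complete_on C E" if "C \<in> connected_components n E" for C
  proof -
    from that obtain x where C: "C = (adj_rel E)\<^sup>* `` {x}"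
      by (auto simp: connected_components_def elim: quotientE)
    show ?thesis
      unfolding complete_on_def
    proof (intro ballI impI)
      fix u v assume "u \<in> C" "v \<in> C" "u \<noteq> v"
      then have "x = u \<or> {x, u} \<in> E" "x = v \<or> {x, v} \<in> E"
        using reach by (auto simp: C)
      then show "{u, v} \<in> E"
        using \<open>u \<noteq> v\<close> cluster_graphs_on_trans[OF *, of u x v] by (auto simp: insert_commute[of x u])
    qed
  qed
  with * show "cluster_graph n E"
    by (auto simp: cluster_graph_def cluster_graphs_on_def vertex_pairs_def)
qed

definition neighbours :: "nat set set \<Rightarrow> nat \<Rightarrow> nat set" where
  "neighbours E v = {u. {u, v} \<in> E}"

lemma degree_eq_card_neighbours:
  assumes "E \<in> cluster_graphs_on A"
  shows "degree E v = card (neighbours E v)"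
proof -
  have "{e \<in> E. v \<in> e} = (\<lambda>u. {u, v}) ` neighbours E v"
  proof (intro equalityI subsetI)
    fix e assume "e \<in> {e \<in> E. v \<in> e}"
    then have e: "e \<in> E" "v \<in> e" by auto
    then obtain x y where "e = {x, y}" using cluster_graphs_on_edgeE[OF assms] by metis
    with e have "e = {x, v} \<or> e = {y, v}" by auto
    with e show "e \<in> (\<lambda>u. {u, v}) ` neighbours E v" by (auto simp: neighbours_def)
  qed (auto simp: neighbours_def)
  moreover have "inj_on (\<lambda>u. {u, v}) (neighbours E v)"
    by (auto simp: inj_on_def doubleton_eq_iff)
  ultimately show ?thesis
    by (simp add: degree_def card_image)
qed

text \<open>A cluster graph is given by the clique of a fixed vertex \<open>v\<close> and a cluster graph on the rest.\<close>

lemma cluster_graphs_on_bij: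
  assumes v: "v \<in> A"
  shows "bij_betw (\<lambda>E. (neighbours E v, {e \<in> E. e \<inter> insert v (neighbours E v) = {}}))
    (cluster_graphs_on A) (SIGMA N:Pow (A - {v}). cluster_graphs_on (A - {v} - N))"
proof (rule bij_betwI[where g = "\<lambda>(N, F). F \<union> {e. e \<subseteq> insert v N \<and> card e = 2}"])
  show "(\<lambda>E. (neighbours E v, {e \<in> E. e \<inter> insert v (neighbours E v) = {}}))
    \<in> cluster_graphs_on A \<rightarrow> (SIGMA N:Pow (A - {v}). cluster_graphs_on (A - {v} - N))"
  proof safe
    fix E u assume E: "E \<in> cluster_graphs_on A" and "u \<in> neighbours E v"
    then have "{u, v} \<in> E" by (simp add: neighbours_def)
    from cluster_graphs_on_edge[OF E this] show "u \<in> A" by simp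
  next
    fix E assume E: "E \<in> cluster_graphs_on A" "v \<in> neighbours E v"
    then have "{v, v} \<in> E" by (simp add: neighbours_def)
    from cluster_graphs_on_edge[OF E(1) this] show False by simp
  next
    fix E assume "E \<in> cluster_graphs_on A"
    then show "{e \<in> E. e \<inter> insert v (neighbours E v) = {}}
        \<in> cluster_graphs_on (A - {v} - neighbours E v)"
      unfolding cluster_graphs_on_def by blast
  qed
next
  show "(\<lambda>(N, F). F \<union> {e. e \<subseteq> insert v N \<and> card e = 2})
    \<in> (SIGMA N:Pow (A - {v}). cluster_graphs_on (A - {v} - N)) \<rightarrow> cluster_graphs_on A"
  proof safe
    fix N F assume N: "N \<subseteq> A - {v}" and F: "F \<in> cluster_graphs_on (A - {v} - N)"
    let ?E = "F \<union> {e. e \<subseteq> insert v N \<and> card e = 2}"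
    have "?E \<subseteq> {e. e \<subseteq> A \<and> card e = 2}"
      using N F v by (auto simp: cluster_graphs_on_def)
    moreover have "{x, z} \<in> ?E" if "{x, y} \<in> ?E" "{y, z} \<in> ?E" "x \<noteq> z" for x y z
    \<comment> \<open>The middle vertex decides: inside the new clique neither edge is in
      \<open>F\<close>, outside it both are.\<close>
    proof (cases "y \<in> insert v N")
      case True
      then have "{x, y} \<notin> F" "{y, z} \<notin> F"
        using cluster_graphs_on_edge[OF F] by blast+
      with that show ?thesis by auto
    next
      case False
      with that have "{x, y} \<in> F" "{y, z} \<in> F" by auto
      then show ?thesis using cluster_graphs_on_trans[OF F] that by blast
    qed
    ultimately show "?E \<in> cluster_graphs_on A"
      unfolding cluster_graphs_on_def by blast
  qed
next
  fix E assume E: "E \<in> cluster_graphs_on A"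
  have "e \<in> E \<longleftrightarrow> (e \<in> E \<and> e \<inter> insert v (neighbours E v) = {})
      \<or> (e \<subseteq> insert v (neighbours E v) \<and> card e = 2)" for e
  proof
    assume "e \<in> E"
    then obtain x y where e: "e = {x, y}" "x \<noteq> y"
      using cluster_graphs_on_edgeE[OF E] by metis
    \<comment> \<open>The clique of \<open>v\<close> is closed under adjacency, so an edge meeting
      it lies inside it.\<close>
    have "y' \<in> insert v (neighbours E v)" if "{x', y'} \<in> E" "x' \<in> insert v (neighbours E v)"
      for x' y'
      using that cluster_graphs_on_trans[OF E, of y' x' v]
        by (auto simp: neighbours_def insert_commute)
    from this[of x y] this[of y x] show
      "(e \<in> E \<and> e \<inter> insert v (neighbours E v) = {}) \<or> (e \<subseteq> insert v (neighbours E v) \<and> card e = 2)"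
      using e \<open>e \<in> E\<close> by (auto simp: insert_commute)
  next
    assume "(e \<in> E \<and> e \<inter> insert v (neighbours E v) = {})
        \<or> (e \<subseteq> insert v (neighbours E v) \<and> card e = 2)"
    then show "e \<in> E"
    proof
      assume "e \<subseteq> insert v (neighbours E v) \<and> card e = 2"
      then obtain x y where "e = {x, y}" "x \<noteq> y" "x \<in> insert v (neighbours E v)"
        "y \<in> insert v (neighbours E v)"
        by (auto simp: card_2_iff)
      then show "e \<in> E"
        using cluster_graphs_on_trans[OF E, of x v y] by (auto simp: neighbours_def insert_commute)
    qed simp
  qed
  then show "(\<lambda>(N, F). F \<union> {e. e \<subseteq> insert v N \<and> card e = 2})
      (neighbours E v, {e \<in> E. e \<inter> insert v (neighbours E v) = {}}) = E"
    by auto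
next
  fix NF assume "NF \<in> (SIGMA N:Pow (A - {v}). cluster_graphs_on (A - {v} - N))"
  then obtain N F where NF: "NF = (N, F)" and N: "N \<subseteq> A - {v}" and F:
    "F \<in> cluster_graphs_on (A - {v} - N)"
    by auto
  let ?E = "F \<union> {e. e \<subseteq> insert v N \<and> card e = 2}"
  have "{u, v} \<in> ?E \<longleftrightarrow> u \<in> N" for u
  proof -
    have "{u, v} \<notin> F" using cluster_graphs_on_edge(2)[OF F] by blast
    then show ?thesis using N by (auto simp: card_insert_if)
  qed
  then have nb: "neighbours ?E v = N" by (simp add: neighbours_def)
  have "e \<inter> insert v N = {}" if "e \<in> F" for e
    using that F by (auto simp: cluster_graphs_on_def)
  moreover have "e \<inter> insert v N \<noteq> {}" if "e \<subseteq> insert v N" "card e = 2" for e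
    using that by (metis card.empty inf.absorb1 zero_neq_numeral)
  ultimately have "{e \<in> ?E. e \<inter> insert v N = {}} = F" by auto
  with nb show "(\<lambda>E. (neighbours E v, {e \<in> E. e \<inter> insert v (neighbours E v) = {}}))
      ((\<lambda>(N, F). F \<union> {e. e \<subseteq> insert v N \<and> card e = 2}) NF) = NF"
    by (simp add: NF)
qed

lemma sum_Pow_card:
  fixes g :: "nat \<Rightarrow> 'b::comm_semiring_1"
  assumes "finite A"
  shows "(\<Sum>N\<in>Pow A. g (card N)) = (\<Sum>k\<le>card A. of_nat (card A choose k) * g k)"
proof -
  have "(\<Sum>k\<le>card A. \<Sum>N | N \<in> Pow A \<and> card N = k. g (card N)) = (\<Sum>N\<in>Pow A. g (card N))"
    using assms by (intro sum.group) (auto intro: card_mono)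
  moreover have "(\<Sum>N | N \<in> Pow A \<and> card N = k. g (card N)) = of_nat (card A choose k) * g k" for k
    using assms by (simp add: n_subsets)
  ultimately show ?thesis by simp
qed

text \<open>With \<open>f = 1\<close> this becomes the recurrence for the number of cluster graphs,
  with general \<open>f\<close> the law of the degree.\<close>

lemma sum_degree_cluster_graphs_on:
  fixes f :: "nat \<Rightarrow> 'b::comm_semiring_1"
  assumes "finite A" "v \<in> A"
  shows "(\<Sum>E\<in>cluster_graphs_on A. f (degree E v)) =
    (\<Sum>N\<in>Pow (A - {v}). f (card N) * of_nat (card (cluster_graphs_on (A - {v} - N))))"
proof -
  have "(\<Sum>E\<in>cluster_graphs_on A. f (degree E v))
      = (\<Sum>E\<in>cluster_graphs_on A. f (card (neighbours E v)))"
    by (rule sum.cong) (simp_all add: degree_eq_card_neighbours)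
  also have "\<dots> = (\<Sum>(N, F)\<in>(SIGMA N:Pow (A - {v}). cluster_graphs_on (A - {v} - N)). f (card N))"
    using sum.reindex_bij_betw[OF cluster_graphs_on_bij[OF assms(2)], of "\<lambda>(N, F). f (card N)"]
      by simp
  also have "\<dots> = (\<Sum>N\<in>Pow (A - {v}). \<Sum>F\<in>cluster_graphs_on (A - {v} - N). f (card N))"
    using assms by (intro sum.Sigma[symmetric]) (auto intro: finite_cluster_graphs_on)
  finally show ?thesis by (simp add: mult.commute)
qed

text \<open>Choosing the clique of one vertex reproduces the recurrence \<open>bell_Suc\<close>,
  which ties Dobinski's numbers to the count of set partitions.\<close>

lemma card_cluster_graphs_on:
  assumes "finite A"
  shows "real (card (cluster_graphs_on A)) = bell (card A)"
  using assms
proof (induction "card A" arbitrary: A rule: less_induct)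
  case less
  show ?case
  proof (cases "A = {}")
    case True
    then have "cluster_graphs_on A = {{}}" by (auto simp: cluster_graphs_on_def)
    then show ?thesis using True by simp
  next
    case False
    then obtain v where v: "v \<in> A" by auto
    define n where "n = card (A - {v})"
    have cA: "card A = Suc n"
      using v less.prems card_Suc_Diff1 by (fastforce simp: n_def)
    have "real (card (cluster_graphs_on A)) = (\<Sum>E\<in>cluster_graphs_on A. 1)" by simp
    also have "\<dots> = (\<Sum>N\<in>Pow (A - {v}). 1 * real (card (cluster_graphs_on (A - {v} - N))))"
      using less.prems v by (rule sum_degree_cluster_graphs_on[where f = "\<lambda>_. 1"])
    also have "\<dots> = (\<Sum>N\<in>Pow (A - {v}). bell (n - card N))"
    proof (rule sum.cong)
      fix N assume N: "N \<in> Pow (A - {v})"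
      then have "card (A - {v} - N) = n - card N"
        using less.prems by (subst card_Diff_subset) (auto simp: n_def intro: finite_subset)
      moreover from this have
        "real (card (cluster_graphs_on (A - {v} - N))) = bell (card (A - {v} - N))"
        using less.prems cA by (intro less.hyps) auto
      ultimately show "1 * real (card (cluster_graphs_on (A - {v} - N))) = bell (n - card N)"
        by simp
    qed simp
    also have "\<dots> = bell (card A)"
      using less.prems by (subst sum_Pow_card) (simp_all add: cA bell_Suc n_def)
    finally show ?thesis .
  qed
qed

section \<open>The law of the root degree\<close>

text \<open>At edge probability \<open>1 / 2\<close> all graphs are equally likely, and conditioning
  a uniform law leaves it uniform.\<close>

lemma random_cluster_graph_half:
  "random_cluster_graph n (1 / 2) = pmf_of_set (cluster_graphs_on {1..n})"
proof -
  have fin: "finite (vertex_pairs n)"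
    by (rule finite_subset[of _ "Pow {1..n}"]) (auto simp: vertex_pairs_def)
  have er: "erdos_renyi n (1 / 2) = pmf_of_set (Pow (vertex_pairs n))"
    unfolding erdos_renyi_def by (rule pmf_of_set_Pow_conv_bernoulli[OF fin])
  have eq: "Pow (vertex_pairs n) \<inter> {E. cluster_graph n E} = cluster_graphs_on {1..n}"
    by (auto simp: cluster_graph_iff cluster_graphs_on_def vertex_pairs_def)
  have ne: "set_pmf (pmf_of_set (Pow (vertex_pairs n))) \<inter> {E. cluster_graph n E} \<noteq> {}"
    unfolding er[symmetric] by (rule erdos_renyi_meets_cluster_graph) simp_all
  have "finite (cluster_graphs_on {1..n})" "cluster_graphs_on {1..n} \<noteq> {}"
    using cluster_graph_empty[of n] by (auto simp: cluster_graph_iff finite_cluster_graphs_on)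
  moreover have "E \<in> Pow (vertex_pairs n)" if "E \<in> cluster_graphs_on {1..n}" for E
    using that eq by blast
  moreover have "card (cluster_graphs_on {1..n}) \<noteq> 0" "card (Pow (vertex_pairs n)) \<noteq> 0"
    using calculation(1,2) fin by (auto simp: card_Pow)
  ultimately show ?thesis
    unfolding random_cluster_graph_def er using fin
    by (intro pmf_eqI)
      (auto simp: pmf_cond[OF ne] measure_pmf_of_set eq cluster_graph_iff indicator_def)
qed

text \<open>Every root gives the same sum, so averaging over the root changes nothing. The general
  codomain serves real moments and the complex characteristic function alike.\<close>

lemma expectation_rooted_cluster_graph:
  fixes f :: "nat \<Rightarrow> 'b::{real_normed_field, banach, second_countable_topology}"
  shows "(\<integral>(E, v). f (degree E v) \<partial>measure_pmf (rooted_cluster_graph (Suc n) (1 / 2)))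
     = (\<Sum>k\<le>n. of_nat (n choose k) * of_real (bell (n - k)) * f k) / of_real (bell (Suc n))"
proof -
  let ?A = "{1..Suc n}" and ?G = "cluster_graphs_on {1..Suc n}"
  have fin: "finite ?G" by (simp add: finite_cluster_graphs_on)
  have "?G \<noteq> {}"
    using cluster_graph_empty cluster_graph_iff by blast
  have cG: "real (card ?G) = bell (Suc n)"
    by (simp add: card_cluster_graphs_on)
  have P: "rooted_cluster_graph (Suc n) (1 / 2) = pmf_of_set (?G \<times> ?A)"
    unfolding rooted_cluster_graph_def random_cluster_graph_half
    using fin \<open>?G \<noteq> {}\<close>
      by (intro pmf_eqI) (auto simp: pmf_pair split_paired_all indicator_def
        card_cartesian_product algebra_simps)
  have root: "(\<Sum>E\<in>?G. f (degree E v)) = (\<Sum>k\<le>n. of_nat (n choose k) * of_real (bell (n - k)) * f k)"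
    if v: "v \<in> ?A" for v
  proof -
    have cAv: "card (?A - {v}) = n" using v by simp
    have "(\<Sum>E\<in>?G. f (degree E v)) =
      (\<Sum>N\<in>Pow (?A - {v}). f (card N) * of_nat (card (cluster_graphs_on (?A - {v} - N))))"
      using v by (intro sum_degree_cluster_graphs_on) auto
    also have "\<dots> = (\<Sum>N\<in>Pow (?A - {v}). f (card N) * of_real (bell (n - card N)))"
    proof (rule sum.cong)
      fix N assume "N \<in> Pow (?A - {v})"
      then have "card (?A - {v} - N) = n - card N"
        using cAv by (subst card_Diff_subset) (auto intro: finite_subset)
      then have "real (card (cluster_graphs_on (?A - {v} - N))) = bell (n - card N)"
        by (simp add: card_cluster_graphs_on)
      then show "f (card N) * of_nat (card (cluster_graphs_on (?A - {v} - N)))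
          = f (card N) * of_real (bell (n - card N))"
        by (metis of_real_of_nat_eq)
    qed simp
    also have "\<dots> = (\<Sum>k\<le>n. of_nat (n choose k) * of_real (bell (n - k)) * f k)"
      unfolding sum_Pow_card[of "?A - {v}"
        "\<lambda>k. f k * of_real (bell (n - k))", simplified cAv, OF finite_Diff[OF finite_atLeastAtMost]]
      by (simp add: mult_ac)
    finally show ?thesis .
  qed
  have "(\<integral>(E, v). f (degree E v) \<partial>measure_pmf (rooted_cluster_graph (Suc n) (1 / 2)))
     = (\<Sum>(E, v)\<in>?G \<times> ?A. f (degree E v)) / of_nat (card (?G \<times> ?A))"
    unfolding P using fin \<open>?G \<noteq> {}\<close>
    by (subst integral_measure_pmf[of
      "?G \<times> ?A"]) (auto simp: sum_divide_distrib scaleR_conv_of_real algebra_simps intro!: sum.cong)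
  also have "(\<Sum>(E, v)\<in>?G \<times> ?A. f (degree E v)) = (\<Sum>v\<in>?A. \<Sum>E\<in>?G. f (degree E v))"
    by (simp only: sum.cartesian_product[symmetric]) (rule sum.swap)
  also have "\<dots> = (\<Sum>v\<in>?A. \<Sum>k\<le>n. of_nat (n choose k) * of_real (bell (n - k)) * f k)"
    by (rule sum.cong[OF refl root])
  also have "\<dots> = of_nat (Suc n) * (\<Sum>k\<le>n. of_nat (n choose k) * of_real (bell (n - k)) * f k)"
    by (simp only: sum_constant card_atLeastAtMost) simp
  also have "of_nat (card (?G \<times> ?A)) = of_nat (Suc n) * of_real (bell (Suc n))"
    by (simp add: card_cartesian_product cG[symmetric] algebra_simps)
  finally show ?thesis by (simp del: of_nat_Suc)
qed

section \<open>The characteristic function of the root degree\<close>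

lemma norm_exp_minus_one_minus_le:
  fixes w :: complex
  shows "norm (exp w - 1 - w) \<le> exp \<bar>Re w\<bar> * norm w ^ 2"
  using Taylor_exp[of w 1] by (simp add: numeral_2_eq_2 diff_diff_eq)

text \<open>\<open>?phi\<close> is the mean of \<open>(1 + z/M) ^ N\<close> under Dobinski's
  mixture. Replacing each base by \<open>exp (a * z)\<close>, where \<open>a\<close> is the mean of
  \<open>1/M\<close>, costs a factor \<open>N\<close>, as all bases lie in the unit disc. The first
  error term stems from the fluctuation of \<open>1/M\<close> about \<open>a\<close>, the second
  from the Taylor remainder of \<open>exp\<close>.\<close>

lemma root_degree_pgf_bound:
  fixes z :: complex and k :: nat
  defines "N \<equiv> Suc k"
  defines "a \<equiv> 1 / bell_ratio N"
  assumes k: "k > 0" and z: "norm (1 + z) = 1"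
  shows "norm ((\<Sum>j\<le>N. of_nat (N choose j) * of_real (bell (N - j)) * (1 + z) ^ j)
      / of_real (bell (Suc N))
      - exp (of_real (N * a) * z))
    \<le> N * a * (norm z * sqrt (2 / bell_ratio k)) + exp 2
      * (norm z ^ 2 * (N * a) * a)" (is "norm (?phi - _) \<le> _")
proof -
  define e where "e = exp 1 * bell (Suc N)"
  have e: "e > 0" by (simp add: e_def)
  \<comment> \<open>\<open>W\<close> is the law of \<open>M - 1\<close>, so that \<open>u\<close> stands for \<open>1/M\<close>.\<close>
  define W where "W = (\<lambda>m. real (Suc m) ^ N / fact m / e)"
  define u where "u = (\<lambda>m. 1 / real (Suc m))"
  define a' where "a' = 1 / bell_ratio k"
  have a: "0 < a" "0 < a'" by (simp_all add: a_def a'_def)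
  have a_le: "a \<le> 1"
    using bell_mono_Suc[of N] by (simp add: a_def bell_ratio_def)
  have u: "0 \<le> u m" "u m \<le> 1" for m by (simp_all add: u_def)
  have W: "0 \<le> W m" for m using e by (simp add: W_def)
  have sum_W: "W sums 1"
    using sums_divide[OF bell_Suc_sums[of N], of e] e by (simp add: W_def e_def)
  have sum_Wu: "(\<lambda>m. W m * u m) sums a"
  proof -
    have "W m * u m = real (Suc m) ^ k / fact m / e" for m
      by (simp add: W_def u_def N_def del: of_nat_Suc)
    moreover have "exp 1 * bell (Suc k) / e = a"
      by (simp add: a_def e_def N_def bell_ratio_def)
    ultimately show ?thesis
      using sums_divide[OF bell_Suc_sums[of k], of e] by simp
  qed
  have sum_Wuu: "(\<lambda>m. W m * u m ^ 2) sums (a * a')"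
  proof -
    \<comment> \<open>Cancelling two factors \<open>m + 1\<close> from \<open>(m + 1) ^ N\<close>
      leaves the exponent \<open>k - 1\<close>; here \<open>k > 0\<close> enters.\<close>
    obtain j where j: "k = Suc j" using k by (cases k) auto
    have "W m * u m ^ 2 = real (Suc m) ^ j / fact m / e" for m
      by (simp add: W_def u_def N_def j power2_eq_square del: of_nat_Suc)
    moreover have "exp 1 * bell (Suc j) / e = a * a'"
      by (simp add: a_def a'_def e_def N_def j bell_ratio_def)
    ultimately show ?thesis
      using sums_divide[OF bell_Suc_sums[of j], of e] by simp
  qed
  \<comment> \<open>\<open>\<delta>\<close> bounds the standard deviation of \<open>1/M\<close>.\<close>
  define \<delta> where "\<delta> = a * sqrt (2 * a')"
  have \<delta>: "\<delta> > 0" using a by (simp add: \<delta>_def)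
  \<comment> \<open>The left side is the variance of \<open>u\<close>. It is proportional to an
    increment of the ratios, so the increment bound makes it small.\<close>
  have V: "a * a' - a ^ 2 \<le> \<delta> ^ 2"
  proof -
    have "a * a' - a ^ 2 = a ^ 2 * a' * (bell_ratio (Suc k) - bell_ratio k)"
      by (simp add: a_def a'_def N_def field_simps power2_eq_square)
    also have "\<dots> \<le> a ^ 2 * a' * 2"
      using bell_ratio_Suc_le[of k] a by (intro mult_left_mono) auto
    also have "\<dots> = \<delta> ^ 2"
      using a by (simp add: \<delta>_def power_mult_distrib)
    finally show ?thesis .
  qed
  \<comment> \<open>The distance of \<open>u m\<close> from \<open>a\<close> is bounded by the
    arithmetic-geometric mean inequality. The result is quadratic in \<open>u m\<close>, so the
    three moment series above sum it.\<close>
  define g where "g = (\<lambda>m. W m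
      * (N * (norm z * ((\<delta> + (u m - a) ^ 2 / \<delta>) / 2) + exp 2 * (norm z * a) ^ 2)))"
  define B where "B = N * (norm z * ((\<delta> + (a * a' - a ^ 2) / \<delta>) / 2) + exp 2 * (norm z * a) ^ 2)"
  have sum_g: "g sums B"
  proof -
    have "(\<lambda>m. N * norm z / (2 * \<delta>) * (W m * u m ^ 2) - N * norm z / \<delta> * a * (W m * u m)
        + N * (norm z * ((\<delta> + a ^ 2 / \<delta>) / 2) + exp 2 * (norm z * a) ^ 2) * W m) sums
       (N * norm z / (2 * \<delta>) * (a * a') - N * norm z / \<delta> * a * a
        + N * (norm z * ((\<delta> + a ^ 2 / \<delta>) / 2) + exp 2 * (norm z * a) ^ 2) * 1)"
      by (intro sums_add sums_diff sums_mult sum_W sum_Wu sum_Wuu)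
    moreover have "N * norm z / (2 * \<delta>) * (W m * u m ^ 2) - N * norm z / \<delta> * a * (W m * u m)
        + N * (norm z * ((\<delta> + a ^ 2 / \<delta>) / 2) + exp 2 * (norm z * a) ^ 2) * W m = g m" for m
      using \<delta> by (simp add: g_def field_simps power2_eq_square)
    moreover have "N * norm z / (2 * \<delta>) * (a * a') - N * norm z / \<delta> * a * a
        + N * (norm z * ((\<delta> + a ^ 2 / \<delta>) / 2) + exp 2 * (norm z * a) ^ 2) * 1 = B"
      using \<delta> by (simp add: B_def field_simps power2_eq_square)
    ultimately show ?thesis by simp
  qed
  define E where "E = exp (of_real a * z) ^ N"
  define f where "f = (\<lambda>m. of_real (W m) * ((1 + of_real (u m) * z) ^ N - E))"
  have sum_f: "f sums (?phi - E)"
  proof -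
    have "(\<lambda>m. (of_nat m + (1 + z)) ^ N / fact m / of_real e - E * of_real (W m))
        sums (?phi - E * of_real 1)"
    proof (intro sums_diff sums_mult sums_of_real sum_W)
      show "(\<lambda>m. (of_nat m + (1 + z)) ^ N / fact m / of_real e) sums ?phi"
        using sums_divide[OF bell_binomial_sums[of "1 + z" N], of "of_real e"] by (simp add: e_def)
    qed
    moreover have "(of_nat m + (1 + z)) ^ N / fact m / of_real e - E * of_real (W m) = f m" for m
    proof -
      \<comment> \<open>Pulling \<open>m + 1\<close> out of \<open>m + 1 + z\<close> produces the
        weight \<open>W m\<close> and the binomial generating function with parameter
        \<open>u m\<close>.\<close>
      have "of_nat (Suc m) * complex_of_real (u m) = 1"
        by (simp add: u_def del: of_nat_Suc)
      then have "of_nat (Suc m) * (1 + of_real (u m) * z) = of_nat (Suc m) + z"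
        by (simp only: distrib_left mult.assoc[symmetric]) simp
      then have "of_nat m + (1 + z) = of_nat (Suc m) * (1 + of_real (u m) * z)"
        by simp
      then have "(of_nat m + (1 + z)) ^ N / fact m / of_real e
          = of_real (W m) * (1 + of_real (u m) * z) ^ N"
        by (simp only: power_mult_distrib) (simp add: W_def del: of_nat_Suc)
      then show ?thesis by (simp add: f_def algebra_simps)
    qed
    ultimately show ?thesis by simp
  qed
  have Re: "Re z \<le> 0" "\<bar>Re z\<bar> \<le> 2"
    using abs_Re_le_cmod[of "1 + z"] z by auto
  have fg: "norm (f m) \<le> g m" for m
  proof -
    \<comment> \<open>A convex combination of \<open>1\<close> and \<open>1 + z\<close>, both of
      modulus \<open>1\<close>.\<close>
    have "norm (1 + of_real (u m) * z) = norm (of_real (1 - u m) + of_real (u m) * (1 + z))"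
      by (simp add: algebra_simps)
    also have "\<dots> \<le> norm (complex_of_real (1 - u m)) + norm (of_real (u m) * (1 + z))"
      by (rule norm_triangle_ineq)
    also have "\<dots> = 1" using u[of m] z by (simp only: norm_mult norm_of_real)
    finally have "norm (1 + of_real (u m) * z) \<le> 1" .
    moreover have "norm (exp (of_real a * z)) \<le> 1"
      using Re a by (simp add: mult_nonneg_nonpos)
    ultimately have "norm ((1 + of_real (u m) * z) ^ N - E)
        \<le> N * norm (1 + of_real (u m) * z - exp (of_real a * z))"
      unfolding E_def by (rule norm_power_diff)
    also have "norm (1 + of_real (u m) * z - exp (of_real a * z))
      = norm (of_real (u m - a) * z - (exp (of_real a * z) - 1 - of_real a * z))"
      by (simp add: algebra_simps)
    also have "\<dots> \<le> norm (of_real (u m - a) * z) + norm (exp (of_real a * z) - 1 - of_real a * z)"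
      by (rule norm_triangle_ineq4)
    also have "norm (of_real (u m - a) * z) = norm z * \<bar>u m - a\<bar>"
      by (simp only: norm_mult norm_of_real mult.commute[of _ "norm z"])
    also have "\<bar>u m - a\<bar> \<le> (\<delta> + (u m - a) ^ 2 / \<delta>) / 2"
    proof -
      have "0 \<le> (\<delta> - \<bar>u m - a\<bar>) ^ 2" by simp
      then show ?thesis using \<delta> by (simp add: field_simps power2_eq_square)
    qed
    also have "norm (exp (of_real a * z) - 1 - of_real a * z) \<le> exp 2 * (norm z * a) ^ 2"
    proof -
      have "a * \<bar>Re z\<bar> \<le> 1 * 2"
        using Re a a_le by (intro mult_mono) auto
      then have "\<bar>Re (of_real a * z)\<bar> \<le> 2"
        using a by (simp add: abs_mult)
      then have "exp \<bar>Re (of_real a * z)\<bar> * norm (of_real a * z) ^ 2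
          \<le> exp 2 * norm (of_real a * z) ^ 2"
        by (intro mult_right_mono) simp_all
      with norm_exp_minus_one_minus_le[of "of_real a * z"] show ?thesis
        using a by (simp add: norm_mult mult.commute)
    qed
    finally have "norm ((1 + of_real (u m) * z) ^ N - E)
        \<le> N * (norm z * ((\<delta> + (u m - a) ^ 2 / \<delta>) / 2) + exp 2 * (norm z * a) ^ 2)"
      by (simp add: mult_left_mono)
    then show ?thesis
      using W[of m] by (simp add: f_def g_def norm_mult mult_left_mono)
  qed
  have "norm (?phi - E) \<le> B"
    using norm_suminf_le[OF fg sums_summable[OF sum_g]] sums_unique[OF sum_f] sums_unique[OF sum_g]
    by simp
  also have "B \<le> N * (norm z * \<delta> + exp 2 * (norm z * a) ^ 2)"
  proof -
    have "(a * a' - a ^ 2) / \<delta> \<le> \<delta>"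
      using V \<delta> by (simp add: field_simps power2_eq_square)
    then have "(\<delta> + (a * a' - a ^ 2) / \<delta>) / 2 \<le> \<delta>" by simp
    then show ?thesis
      unfolding B_def by (intro mult_left_mono add_right_mono) auto
  qed
  also have "\<dots> = N * a * (norm z * sqrt (2 / bell_ratio k)) + exp 2 * (norm z ^ 2 * (N * a) * a)"
    by (simp add: \<delta>_def a'_def algebra_simps power2_eq_square)
  also have "E = exp (of_real (N * a) * z)"
    unfolding E_def exp_of_nat_mult[symmetric] by (simp add: mult_ac)
  finally show ?thesis .
qed

section \<open>The Poisson limit\<close>

text \<open>For positive \<mu> this is the characteristic function of a Poisson law of mean \<mu>,
  centred and divided by \<sigma>. Expanding the exponent to second order leaves an error of order
  \<mu> divided by the cube of \<sigma>.\<close>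

lemma tendsto_exp_centred_poisson:
  fixes \<mu> \<sigma> :: "nat \<Rightarrow> real"
  assumes ratio: "(\<lambda>k. \<mu> k / \<sigma> k ^ 2) \<longlonglongrightarrow> 1" and \<sigma>: "filterlim \<sigma> at_top sequentially"
  shows "(\<lambda>k. exp (of_real (\<mu> k) * (iexp (t / \<sigma> k) - 1 - \<i> * of_real (t / \<sigma> k))))
    \<longlonglongrightarrow> of_real (exp (- t\<^sup>2 / 2))"
proof -
  define h where "h = (\<lambda>k. of_real (\<mu> k) * (iexp (t / \<sigma> k) - 1 - \<i> * of_real (t / \<sigma> k)))"
  have main: "(\<lambda>k. complex_of_real (- t\<^sup>2 / 2 * (\<mu> k / \<sigma> k ^ 2))) \<longlonglongrightarrow> of_real (- t\<^sup>2 / 2 * 1)"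
    by (intro tendsto_of_real tendsto_mult_left ratio)
  have "(\<lambda>k. h k - of_real (- t\<^sup>2 / 2 * (\<mu> k / \<sigma> k ^ 2))) \<longlonglongrightarrow> 0"
  proof (rule Lim_null_comparison)
    have "(\<lambda>k. \<bar>t\<bar> ^ 3 / 6 * \<bar>\<mu> k / \<sigma> k ^ 2\<bar> * \<bar>inverse (\<sigma> k)\<bar>) \<longlonglongrightarrow> \<bar>t\<bar> ^ 3 / 6 * \<bar>1\<bar> * \<bar>0\<bar>"
      by (intro tendsto_mult tendsto_rabs tendsto_const ratio tendsto_inverse_0_at_top \<sigma>)
    then show "(\<lambda>k. \<bar>t\<bar> ^ 3 / 6 * \<bar>\<mu> k / \<sigma> k ^ 2\<bar> * \<bar>inverse (\<sigma> k)\<bar>) \<longlonglongrightarrow> 0"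
      by simp
    have "norm (h k - of_real (- t\<^sup>2 / 2 * (\<mu> k / \<sigma> k ^ 2)))
        \<le> \<bar>t\<bar> ^ 3 / 6 * \<bar>\<mu> k / \<sigma> k ^ 2\<bar> * \<bar>inverse (\<sigma> k)\<bar>" for k
    proof -
      define x where "x = t / \<sigma> k"
      have sum2: "(\<Sum>j\<le>2. (\<i> * of_real x) ^ j / fact j) = 1 + \<i> * of_real x - of_real (x\<^sup>2 / 2)"
      proof -
        have "{..2::nat} = {0, 1, 2}" by auto
        then show ?thesis by (simp add: power_mult_distrib)
      qed
      have "h k - of_real (- t\<^sup>2 / 2 * (\<mu> k / \<sigma> k ^ 2))
          = of_real (\<mu> k) * (iexp x - (\<Sum>j\<le>2. (\<i> * of_real x) ^ j / fact j))"
        unfolding sum2 unfolding h_def x_def by (simp add: algebra_simps power_divide)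
      also have "norm \<dots> \<le> \<bar>\<mu> k\<bar> * (\<bar>x\<bar> ^ 3 / 6)"
        using iexp_approx1[of x 2]
          by (simp only: norm_mult norm_of_real)
            (intro mult_left_mono; simp add: fact_numeral numeral_3_eq_3)
      \<comment> \<open>For \<open>\<sigma> k = 0\<close> both sides vanish, as division by zero
        yields zero.\<close>
      also have "\<dots> = \<bar>t\<bar> ^ 3 / 6 * \<bar>\<mu> k / \<sigma> k ^ 2\<bar> * \<bar>inverse (\<sigma> k)\<bar>"
        by (cases "\<sigma> k
            = 0") (simp_all add: x_def abs_mult power2_eq_square power3_eq_cube field_simps)
      finally show ?thesis .
    qed
    then show "\<forall>\<^sub>F k in sequentially. norm (h k - of_real (- t\<^sup>2 / 2 * (\<mu> k / \<sigma> k ^ 2)))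
        \<le> \<bar>t\<bar> ^ 3 / 6 * \<bar>\<mu> k / \<sigma> k ^ 2\<bar> * \<bar>inverse (\<sigma> k)\<bar>"
      by simp
  qed
  from tendsto_add[OF this main] have "h \<longlonglongrightarrow> of_real (- t\<^sup>2 / 2)" by simp
  from tendsto_exp[OF this] show ?thesis
    by (simp only: h_def exp_of_real)
qed

section \<open>Mean and variance of the root degree\<close>

text \<open>The index \<open>k\<close> stands for \<open>k + 2\<close> vertices, because the second
  factorial moment reaches down to \<open>bell k\<close>.\<close>

definition mean_root_degree :: "nat \<Rightarrow> real" where
  "mean_root_degree k = real (Suc k) / bell_ratio (Suc k)"

text \<open>Second factorial moment plus mean minus squared mean, with the mean factored out; a
  Poisson law would have \<open>1\<close> in the bracket.\<close>

definition variance_root_degree :: "nat \<Rightarrow> real" where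
  "variance_root_degree k = mean_root_degree k *
     (1 + real k / bell_ratio k - mean_root_degree k)"

lemma expectation_root_degree:
  "measure_pmf.expectation (rooted_cluster_graph (Suc (Suc k)) (1 / 2)) root_degree
      = mean_root_degree k"
proof -
  have "measure_pmf.expectation (rooted_cluster_graph (Suc (Suc k)) (1 / 2)) root_degree
      = (\<Sum>j\<le>Suc k. real j * (real (Suc k choose j) * bell (Suc k - j))) / bell (Suc (Suc k))"
    using expectation_rooted_cluster_graph[where f = real and n = "Suc k"]
    by (simp add: root_degree_def mult_ac del: binomial_Suc_Suc)
  then show ?thesis
    by (simp add: sum_index_mult_choose_bell mean_root_degree_def bell_ratio_def)
qed

lemma variance_root_degree:
  "measure_pmf.variance (rooted_cluster_graph (Suc (Suc k)) (1 / 2)) root_degree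
      = variance_root_degree k"
proof -
  define \<mu> where "\<mu> = mean_root_degree k"
  define c where "c = (\<lambda>j. real (Suc k choose j) * bell (Suc k - j))"
  have "measure_pmf.variance (rooted_cluster_graph (Suc (Suc k)) (1 / 2)) root_degree
      = (\<Sum>j\<le>Suc k. c j * (real j - \<mu>)\<^sup>2) / bell (Suc (Suc k))"
    using expectation_rooted_cluster_graph[where f = "\<lambda>j. (real j - \<mu>)\<^sup>2" and n = "Suc k"]
    unfolding expectation_root_degree \<mu>_def[symmetric]
    by (simp add: root_degree_def c_def case_prod_unfold del: binomial_Suc_Suc)
  also have "(\<Sum>j\<le>Suc k. c j * (real j - \<mu>)\<^sup>2)
      = (\<Sum>j\<le>Suc k. real j * (real j - 1) * c j + (1 - 2 * \<mu>) * (real j * c j) + \<mu>\<^sup>2 * c j)"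
    by (intro sum.cong) (auto simp: algebra_simps power2_eq_square)
  also have "\<dots> = (\<Sum>j\<le>Suc k. real j * (real j - 1) * c j) + (1 - 2 * \<mu>) * (\<Sum>j\<le>Suc k. real j * c j)
      + \<mu>\<^sup>2 * (\<Sum>j\<le>Suc k. c j)"
    by (simp only: sum.distrib sum_distrib_left)
  also have "\<dots> = real (Suc k) * real k * bell k + (1 - 2 * \<mu>) * (real (Suc k) * bell (Suc k))
      + \<mu>\<^sup>2 * bell (Suc (Suc k))"
    unfolding c_def by (simp only: sum_index_mult_pred_choose_bell sum_index_mult_choose_bell
      bell_Suc[of "Suc k", symmetric])
  also have "\<dots> / bell (Suc (Suc k)) = variance_root_degree k"
  proof -
    have "bell k = bell (Suc (Suc k)) / (bell_ratio (Suc k) * bell_ratio k)"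
      "bell (Suc k) = bell (Suc (Suc k)) / bell_ratio (Suc k)"
      by (simp_all add: bell_ratio_def)
    then have "(real (Suc k) * real k * bell k + (1 - 2 * \<mu>) * (real (Suc k) * bell (Suc k)) + \<mu>\<^sup>2
        * bell (Suc (Suc k))) / bell (Suc (Suc k))
       = \<mu> * (real k / bell_ratio k) + (1 - 2 * \<mu>) * \<mu> + \<mu>\<^sup>2"
      by (simp add: \<mu>_def mean_root_degree_def add_divide_distrib del: of_nat_Suc)
    then show ?thesis
      by (simp add: variance_root_degree_def \<mu>_def[symmetric] algebra_simps power2_eq_square)
  qed
  finally show ?thesis .
qed

lemma filterlim_mean_root_degree: "filterlim mean_root_degree at_top sequentially"
  unfolding mean_root_degree_def[abs_def]
  by (rule filterlim_compose[OF filterlim_over_bell_ratio filterlim_Suc])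

lemma tendsto_inverse_bell_ratio: "(\<lambda>k. inverse (bell_ratio k)) \<longlonglongrightarrow> 0"
  by (rule tendsto_inverse_0_at_top[OF filterlim_bell_ratio])

text \<open>The deviation \<open>d\<close> from \<open>1\<close> is one increment of the ratios
  times a null sequence, minus \<open>1 / bell_ratio k\<close>. Monotonicity bounds it below, the
  increment bound above.\<close>

lemma tendsto_variance_over_mean: "(\<lambda>k. variance_root_degree k / mean_root_degree k) \<longlonglongrightarrow> 1"
proof -
  define d where "d = (\<lambda>k. real k / bell_ratio k - mean_root_degree k)"
  have "d \<longlonglongrightarrow> 0"
  proof (rule tendsto_sandwich)
    show "(\<lambda>k. - inverse (bell_ratio k)) \<longlonglongrightarrow> 0"
      using tendsto_minus[OF tendsto_inverse_bell_ratio] by simp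
    show "(\<lambda>k. 2 * (real (Suc k) / (bell_ratio k * bell_ratio (Suc k)))) \<longlonglongrightarrow> 0"
      using tendsto_mult_left[OF tendsto_over_bell_ratio_product, of 2] by simp
    have d: "d k = real (Suc k) / (bell_ratio k * bell_ratio (Suc k))
        * (bell_ratio (Suc k) - bell_ratio k) - inverse (bell_ratio k)" for k
      by (simp add: d_def mean_root_degree_def field_simps)
    have "0 \<le> real (Suc k) / (bell_ratio k * bell_ratio (Suc k))
        * (bell_ratio (Suc k) - bell_ratio k)" for k
      using monoD[OF mono_bell_ratio, of k "Suc k"]
        by (intro mult_nonneg_nonneg) (auto simp: less_imp_le)
    then show "\<forall>\<^sub>F k in sequentially. - inverse (bell_ratio k) \<le> d k"
      by (simp add: d)
    have "d k \<le> 2 * (real (Suc k) / (bell_ratio k * bell_ratio (Suc k)))" for k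
    proof -
      have "real (Suc k) / (bell_ratio k * bell_ratio (Suc k)) * (bell_ratio (Suc k) - bell_ratio k)
          \<le> real (Suc k) / (bell_ratio k * bell_ratio (Suc k)) * 2"
        using bell_ratio_Suc_le[of k] by (intro mult_left_mono) (auto simp: less_imp_le)
      moreover have "0 \<le> inverse (bell_ratio k)" by (simp add: less_imp_le)
      moreover have "x - y \<le> 2 * z" if "x \<le> z * 2" "0 \<le> y" for x y z :: real
        using that by linarith
      ultimately show ?thesis unfolding d by blast
    qed
    then show "\<forall>\<^sub>F k in sequentially. d k
        \<le> 2 * (real (Suc k) / (bell_ratio k * bell_ratio (Suc k)))"
      by simp
  qed
  then have "(\<lambda>k. 1 + d k) \<longlonglongrightarrow> 1 + 0" by (intro tendsto_intros)
  moreover have "variance_root_degree k / mean_root_degree k = 1 + d k" for k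
  proof -
    have "mean_root_degree k \<noteq> 0" by (simp add: mean_root_degree_def)
    then show ?thesis by (simp add: variance_root_degree_def d_def)
  qed
  ultimately show ?thesis by simp
qed

section \<open>Convergence of the characteristic functions\<close>

lemma char_standardized_root_degree:
  fixes k :: nat and t :: real
  defines "\<theta> \<equiv> t / sqrt (variance_root_degree k)"
  defines "P \<equiv> rooted_cluster_graph (Suc (Suc k)) (1 / 2)"
  shows "char (distr (measure_pmf P) borel
       (\<lambda>\<omega>. (root_degree \<omega> - measure_pmf.expectation P root_degree)
         / sqrt (measure_pmf.variance P root_degree))) t
    = iexp (- (\<theta> * mean_root_degree k)) *
      ((\<Sum>j\<le>Suc k. of_nat (Suc k choose j) * of_real (bell (Suc k - j)) * iexp \<theta> ^ j)
        / of_real (bell (Suc (Suc k))))"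
proof -
  define \<mu> where "\<mu> = mean_root_degree k"
  define f where "f = (\<lambda>j. iexp (t * ((real j - \<mu>) / sqrt (variance_root_degree k))))"
  have f: "f j = iexp (- (\<theta> * \<mu>)) * iexp \<theta> ^ j" for j
  proof -
    have "f j = exp (\<i> * of_real (- (\<theta> * \<mu>)) + of_nat j * (\<i> * of_real \<theta>))"
      unfolding f_def \<theta>_def
      by (rule arg_cong[where f = exp]) (simp add: diff_divide_distrib algebra_simps)
    then show ?thesis by (simp only: exp_add exp_of_nat_mult)
  qed
  have "char (distr (measure_pmf P) borel
       (\<lambda>\<omega>. (root_degree \<omega> - measure_pmf.expectation P root_degree)
         / sqrt (measure_pmf.variance P root_degree))) t
     = (\<integral>(E, v). f (degree E v) \<partial>measure_pmf P)"
    unfolding char_def P_def variance_root_degree unfolding expectation_root_degree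
    by (subst integral_distr) (simp_all add: f_def \<mu>_def root_degree_def case_prod_unfold)
  also have "\<dots> = (\<Sum>j\<le>Suc k. of_nat (Suc k choose j) * of_real (bell (Suc k - j)) * f j)
      / of_real (bell (Suc (Suc k)))"
    unfolding P_def by (rule expectation_rooted_cluster_graph)
  also have "\<dots> = iexp (- (\<theta> * \<mu>)) *
      ((\<Sum>j\<le>Suc k. of_nat (Suc k choose j) * of_real (bell (Suc k - j)) * iexp \<theta> ^ j)
        / of_real (bell (Suc (Suc k))))"
    unfolding f times_divide_eq_right sum_distrib_left by (simp only: mult_ac)
  finally show ?thesis by (simp only: \<mu>_def)
qed

text \<open>The generating function at \<open>1 + z = iexp (\<theta> k)\<close> is exchanged for the
  Poisson one \<open>exp (\<mu> k * z)\<close>; the phase factor has modulus \<open>1\<close> and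
  leaves the error unchanged.\<close>

lemma tendsto_char_standardized_root_degree:
  fixes t :: real
  defines "\<theta> \<equiv> \<lambda>k. t / sqrt (variance_root_degree k)"
  shows "(\<lambda>k. iexp (- (\<theta> k * mean_root_degree k)) *
      ((\<Sum>j\<le>Suc k. of_nat (Suc k choose j) * of_real (bell (Suc k - j)) * iexp (\<theta> k) ^ j)
        / of_real (bell (Suc (Suc k)))))
    \<longlonglongrightarrow> of_real (exp (- t\<^sup>2 / 2))" (is "?L \<longlonglongrightarrow> _")
proof -
  define \<mu> where "\<mu> = mean_root_degree"
  define \<sigma> where "\<sigma> = (\<lambda>k. sqrt (variance_root_degree k))"
  have \<mu>_pos: "\<mu> k > 0" for k by (simp add: \<mu>_def mean_root_degree_def)
  \<comment> \<open>Variance at least half the mean: it is then positive, so \<sigma> squares back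
    to it, and it tends to infinity with the mean.\<close>
  have "eventually (\<lambda>k. variance_root_degree k / \<mu> k > 1 / 2) sequentially"
    unfolding \<mu>_def by (rule order_tendstoD(1)[OF tendsto_variance_over_mean]) simp
  then have ev: "eventually (\<lambda>k. variance_root_degree k \<ge> 1 / 2 * \<mu> k \<and> \<sigma> k ^ 2
      = variance_root_degree k) sequentially"
  proof eventually_elim
    case (elim k)
    then have "variance_root_degree k \<ge> 1 / 2 * \<mu> k" using \<mu>_pos[of k] by (simp add: field_simps)
    moreover from this have "\<sigma> k ^ 2 = variance_root_degree k"
      using \<mu>_pos[of k] by (simp add: \<sigma>_def)
    ultimately show ?case by simp
  qed
  have "filterlim variance_root_degree at_top sequentially"
  proof (rule filterlim_at_top_mono)
    show "filterlim (\<lambda>k. 1 / 2 * \<mu> k) at_top sequentially"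
      unfolding \<mu>_def by
        (rule filterlim_tendsto_pos_mult_at_top[OF tendsto_const _ filterlim_mean_root_degree]) simp
    show "eventually (\<lambda>k. 1 / 2 * \<mu> k \<le> variance_root_degree k) sequentially"
      using ev by eventually_elim simp
  qed
  then have \<sigma>_lim: "filterlim \<sigma> at_top sequentially"
    unfolding \<sigma>_def by (rule filterlim_compose[OF sqrt_at_top])
  have "(\<lambda>k. inverse (variance_root_degree k / \<mu> k)) \<longlonglongrightarrow> inverse 1"
    unfolding \<mu>_def by (intro tendsto_inverse tendsto_variance_over_mean) simp
  then have "(\<lambda>k. \<mu> k / variance_root_degree k) \<longlonglongrightarrow> 1" by simp
  moreover have "eventually (\<lambda>k. \<mu> k / variance_root_degree k = \<mu> k / \<sigma> k ^ 2) sequentially"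
    using ev by eventually_elim simp
  ultimately have ratio: "(\<lambda>k. \<mu> k / \<sigma> k ^ 2) \<longlonglongrightarrow> 1"
    by (rule Lim_transform_eventually)
  define C where "C = (\<lambda>k. exp (of_real (\<mu> k) * (iexp (t / \<sigma> k) - 1 - \<i> * of_real (t / \<sigma> k))))"
  \<comment> \<open>The bound of \<open>root_degree_pgf_bound\<close> with \<open>norm z\<close>
    replaced by \<open>\<bar>t\<bar> / \<sigma> k\<close>. Its first term vanishes in the limit
    because \<open>\<mu> k / bell_ratio k\<close> does.\<close>
  define B where "B = (\<lambda>k. \<bar>t\<bar> * sqrt (2 * (\<mu> k / \<sigma> k ^ 2) * (\<mu> k / bell_ratio k))
      + exp 2 * (t\<^sup>2 * (\<mu> k / \<sigma> k ^ 2) * inverse (bell_ratio (Suc k))))"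
  have "(\<lambda>k. ?L k - C k) \<longlonglongrightarrow> 0"
  proof (rule Lim_null_comparison)
    have "(\<lambda>k. \<mu> k / bell_ratio k) \<longlonglongrightarrow> 0"
      using tendsto_over_bell_ratio_product
      by (simp add: \<mu>_def mean_root_degree_def mult.commute del: of_nat_Suc)
    then have "B \<longlonglongrightarrow> \<bar>t\<bar> * sqrt (2 * 1 * 0) + exp 2 * (t\<^sup>2 * 1 * 0)"
      unfolding B_def
      by (intro tendsto_intros ratio filterlim_compose[OF tendsto_inverse_bell_ratio filterlim_Suc])
    then show "B \<longlonglongrightarrow> 0" by simp
    show "\<forall>\<^sub>F k in sequentially. norm (?L k - C k) \<le> B k"
      using ev eventually_gt_at_top[of 0]
    proof eventually_elim
      case (elim k)
      define z where "z = iexp (\<theta> k) - 1"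
      have z: "1 + z = iexp (\<theta> k)" by (simp add: z_def)
      define \<phi> where "\<phi>
          = (\<Sum>j\<le>Suc k. of_nat (Suc k choose j) * of_real (bell (Suc k - j)) * (1 + z) ^ j)
            / of_real (bell (Suc (Suc k)))"
      have \<theta>: "\<theta> k = t / \<sigma> k" by (simp add: \<theta>_def \<sigma>_def)
      have \<sigma>: "\<sigma> k > 0"
        using elim \<mu>_pos[of k] by (simp add: \<sigma>_def)
      have "?L k = iexp (- (\<theta> k * \<mu> k)) * \<phi>"
        by (simp only: \<phi>_def z \<mu>_def)
      moreover have "C k = iexp (- (\<theta> k * \<mu> k)) * exp (of_real (\<mu> k) * z)"
        unfolding C_def exp_add[symmetric] \<theta>[symmetric]
        by (rule arg_cong[where f = exp]) (simp add: z_def algebra_simps)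
      ultimately have "norm (?L k - C k)
          = norm (iexp (- (\<theta> k * \<mu> k)) * (\<phi> - exp (of_real (\<mu> k) * z)))"
        by (simp only: right_diff_distrib)
      also have "\<dots> = norm (\<phi> - exp (of_real (\<mu> k) * z))"
        by (simp only: norm_mult norm_exp_i_times mult_1_left)
      also have "\<dots> \<le> \<mu> k * (norm z * sqrt (2 / bell_ratio k)) + exp 2
          * (norm z ^ 2 * \<mu> k * inverse (bell_ratio (Suc k)))"
        using root_degree_pgf_bound[of k z] elim
        by (simp add: z_def \<phi>_def \<mu>_def mean_root_degree_def inverse_eq_divide del: of_nat_Suc
          binomial_Suc_Suc sum.atMost_Suc)
      also have "\<dots> \<le> \<mu> k * (\<bar>\<theta> k\<bar> * sqrt (2 / bell_ratio k)) + exp 2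
          * (\<bar>\<theta> k\<bar> ^ 2 * \<mu> k * inverse (bell_ratio (Suc k)))"
      proof -
        have "norm z \<le> \<bar>\<theta> k\<bar>"
          using iexp_approx1[of "\<theta> k" 0] by (simp add: z_def)
        then show ?thesis
          using \<mu>_pos[of k] less_imp_le[OF bell_ratio_pos]
          by (intro add_mono mult_left_mono mult_right_mono power_mono) simp_all
      qed
      also have "\<dots> = B k"
      proof -
        have "sqrt (2 * (\<mu> k / \<sigma> k ^ 2) * (\<mu> k / bell_ratio k))
            = sqrt ((\<mu> k / \<sigma> k) ^ 2 * (2 / bell_ratio k))"
          by (simp add: power2_eq_square)
        also have "\<dots> = \<mu> k / \<sigma> k * sqrt (2 / bell_ratio k)"
          using \<sigma> \<mu>_pos[of k] by (simp only: real_sqrt_mult) simp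
        finally have "\<bar>t\<bar> * sqrt (2 * (\<mu> k / \<sigma> k ^ 2) * (\<mu> k / bell_ratio k))
            = \<mu> k * (\<bar>\<theta> k\<bar> * sqrt (2 / bell_ratio k))"
          using \<sigma> by (simp add: \<theta> abs_divide)
        moreover have "\<bar>\<theta> k\<bar> ^ 2 * \<mu> k = t\<^sup>2 * (\<mu> k / \<sigma> k ^ 2)"
          by (simp add: \<theta> power_divide)
        ultimately show ?thesis by (simp only: B_def)
      qed
      finally show ?case .
    qed
  qed
  moreover have "C \<longlonglongrightarrow> of_real (exp (- t\<^sup>2 / 2))"
    unfolding C_def by (rule tendsto_exp_centred_poisson[OF ratio \<sigma>_lim])
  ultimately show ?thesis
    using tendsto_add[of "\<lambda>k. ?L k - C k" 0 sequentially C] by simp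
qed

theorem corollary1p4:
  fixes P :: "nat \<Rightarrow> (nat set set \<times> nat) pmf"
  defines "P \<equiv> \<lambda>n. rooted_cluster_graph n (1 / 2)"
  shows "weak_conv_m
    (\<lambda>n. distr (measure_pmf (P n)) borel
       (\<lambda>\<omega>. (root_degree \<omega> - measure_pmf.expectation (P n) root_degree)
              / sqrt (measure_pmf.variance (P n) root_degree)))
    std_normal_distribution"
proof (rule levy_continuity)
  show "real_distribution (distr (measure_pmf (P n)) borel
       (\<lambda>\<omega>. (root_degree \<omega> - measure_pmf.expectation (P n) root_degree)
              / sqrt (measure_pmf.variance (P n) root_degree)))" for n
    by (rule prob_space.real_distribution_distr[OF measure_pmf.prob_space_axioms]) simp
  show "real_distribution std_normal_distribution"
    by (rule real_dist_normal_dist)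
  show "(\<lambda>n. char (distr (measure_pmf (P n)) borel
       (\<lambda>\<omega>. (root_degree \<omega> - measure_pmf.expectation (P n) root_degree)
              / sqrt (measure_pmf.variance (P n) root_degree))) t)
                \<longlonglongrightarrow> char std_normal_distribution t" for t
    unfolding P_def
  \<comment> \<open>The shift matches the index of \<open>mean_root_degree\<close> and skips
    \<open>n = 0\<close>, where the uniform vertex is unspecified.\<close>
  proof (rule LIMSEQ_offset[where k = 2])
    show "(\<lambda>k. char (distr (measure_pmf (rooted_cluster_graph (k + 2) (1 / 2))) borel
       (\<lambda>\<omega>. (root_degree \<omega>
         - measure_pmf.expectation (rooted_cluster_graph (k + 2) (1 / 2)) root_degree)
              / sqrt (measure_pmf.variance (rooted_cluster_graph (k + 2) (1 / 2)) root_degree))) t)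
       \<longlonglongrightarrow> char std_normal_distribution t"
      unfolding add_2_eq_Suc' char_standardized_root_degree char_std_normal_distribution
      by (rule tendsto_char_standardized_root_degree)
  qed
qed

end
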